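(* Let $S$ be a closed, connected, oriented surface of genus $g\ge1$, let $n\ge 1$, let $\rho:\pi_1(S)\to\mathbb{T}^n$ be a representation and let $\Theta_\rho$ be its associated $n\times 2g$ matrix. Then $\rho$ is dense in $\mathbb{T}^n$ (i.e. $\rho(\pi_1(S))$ is a dense subset of $\mathbb{T}^n$) if and only if $\mathrm{rk}_{\mathbb{Z}}(\Theta_\rho)=n$ and the rows of $\Theta_\rho$ generate a $\pi\mathbb{Q}$-free $\mathbb{Z}$-module.
   Context: $\mathbb{T}^n=(\mathbb{S}^1)^n\cong\mathbb{R}^n/2\pi\mathbb{Z}^n$. Fix a generating system $\alpha_1,\beta_1,\dots,\alpha_g,\beta_g$ of $\pi_1(S)$ with relation $\prod[\alpha_i,\beta_i]=1$. The matrix $\Theta_\rho=(\theta_{i,j})\in\mathrm{M}(n,2g;\mathbb{R})$ has entries in $[0,2\pi)$ defined by $\rho(\alpha_l)=(e^{i\theta_{1,2l-1}},\dots,e^{i\theta_{n,2l-1}})$ and $\rho(\beta_l)=(e^{i\theta_{1,2l}},\dots,e^{i\theta_{n,2l}})$ for $l=1,\dots,g$. For a real matrix $M$, the $\mathbb{Z}$-row rank $\mathrm{rk}_{\mathbb{Z}}(M)$ is the rank of the $\mathbb{Z}$-module generated by the rows of $M$. A $\mathbb{Z}$-module generated by vectors $v_1,\dots,v_k\in\mathbb{R}^d$ is called $\pi\mathbb{Q}$-free if $\langle v_1,\dots,v_k\rangle_{\mathbb{Z}}\cap\pi\mathbb{Q}^d=\{0\}$. *)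

theory Defs
  imports
    "HOL-Algebra.Algebra"
    "HOL-Analysis.Analysis"
    "HOL-Homology.Homology"
    "Jordan_Normal_Form.Matrix"
begin

subsection \<open>The fundamental group\<close>

definition loops :: "'a::topological_space set \<Rightarrow> 'a \<Rightarrow> (real \<Rightarrow> 'a) set" where
  "loops S x = {p. path p \<and> path_image p \<subseteq> S \<and> pathstart p = x \<and> pathfinish p = x}"

text \<open>Paths are total functions on the reals, but \<^const>\<open>homotopic_paths\<close> only looks at their
  restriction to the unit interval, so each class below is a genuine homotopy class rel endpoints.\<close>

definition path_class :: "'a::topological_space set \<Rightarrow> (real \<Rightarrow> 'a) \<Rightarrow> (real \<Rightarrow> 'a) set" where
  "path_class S p = {q. homotopic_paths S p q}"

definition fundamental_group :: "'a::topological_space set \<Rightarrow> 'a \<Rightarrow> (real \<Rightarrow> 'a) set monoid" where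
  "fundamental_group S x =
     \<lparr>carrier = path_class S ` loops S x,
      monoid.mult = (\<lambda>A B. \<Union>p\<in>A. \<Union>q\<in>B. path_class S (p +++ q)),
      one = path_class S (\<lambda>_. x)\<rparr>"

lemma path_class_eq_iff:
  assumes "p \<in> loops S x"
  shows "path_class S p = path_class S q \<longleftrightarrow> homotopic_paths S p q"
proof
  assume eq: "path_class S p = path_class S q"
  have "p \<in> path_class S p" using assms by (simp add: path_class_def loops_def)
  then show "homotopic_paths S p q" unfolding eq by (simp add: path_class_def homotopic_paths_sym)
next
  assume "homotopic_paths S p q"
  then show "path_class S p = path_class S q"
    unfolding path_class_def using homotopic_paths_sym homotopic_paths_trans by blast
qed

lemma loops_const: "x \<in> S \<Longrightarrow> (\<lambda>_. x) \<in> loops S x"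
  by (auto simp: loops_def path_def path_image_def pathstart_def pathfinish_def)

lemma loops_join: "p \<in> loops S x \<Longrightarrow> q \<in> loops S x \<Longrightarrow> p +++ q \<in> loops S x"
  by (auto simp: loops_def path_image_join)

lemma loops_reversepath: "p \<in> loops S x \<Longrightarrow> reversepath p \<in> loops S x"
  by (auto simp: loops_def)

lemma fundamental_group_mult:
  assumes p: "p \<in> loops S x" and q: "q \<in> loops S x"
  shows "path_class S p \<otimes>\<^bsub>fundamental_group S x\<^esub> path_class S q = path_class S (p +++ q)"
proof -
  have eq: "path_class S (p' +++ q') = path_class S (p +++ q)"
    if "p' \<in> path_class S p" "q' \<in> path_class S q" for p' q'
  proof -
    have "homotopic_paths S (p +++ q) (p' +++ q')"
      using that p q by (auto simp: path_class_def loops_def intro: homotopic_paths_join)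
    then show ?thesis
      using path_class_eq_iff[OF loops_join[OF p q]] by metis
  qed
  have "p \<in> path_class S p" "q \<in> path_class S q"
    using p q by (auto simp: path_class_def loops_def)
  then have "(\<Union>p'\<in>path_class S p. \<Union>q'\<in>path_class S q. path_class S (p' +++ q')) = path_class S (p +++ q)"
    using eq by blast
  then show ?thesis
    by (simp add: fundamental_group_def)
qed

text \<open>The library proves the unit and inverse laws for paths in normed spaces only; pushing them
  forward from the unit interval along \<open>p\<close> gives them in any topological space.\<close>

lemma
  assumes p: "p \<in> loops S x"
  shows homotopic_loops_lid: "homotopic_paths S ((\<lambda>_. x) +++ p) p"
    and homotopic_loops_linv: "homotopic_paths S (reversepath p +++ p) (\<lambda>_. x)"
proof -
  let ?I = "{0..1::real}"
  have push: "homotopic_paths S (p \<circ> f) (p \<circ> g)" if "homotopic_paths ?I f g" for f g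
    using that p by (intro homotopic_paths_continuous_image) (auto simp: loops_def path_def path_image_def)
  have id: "path (id :: real \<Rightarrow> real)" "path_image (id :: real \<Rightarrow> real) \<subseteq> ?I"
    "pathstart (id :: real \<Rightarrow> real) = 0" "pathfinish (id :: real \<Rightarrow> real) = 1"
    by (auto simp: path_def path_image_def pathstart_def pathfinish_def continuous_on_id)
  have x: "p 0 = x" "p 1 = x"
    using p by (auto simp: loops_def pathstart_def pathfinish_def)
  have [simp]: "p \<circ> linepath 0 0 = (\<lambda>_. x)" "p \<circ> linepath 1 1 = (\<lambda>_. x)"
    using x by (auto simp: linepath_def)
  have [simp]: "p \<circ> reversepath id = reversepath p"
    by (auto simp: reversepath_def)
  show "homotopic_paths S ((\<lambda>_. x) +++ p) p"
    using push[OF homotopic_paths_lid[OF id(1,2)]] by (simp add: id path_compose_join)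
  show "homotopic_paths S (reversepath p +++ p) (\<lambda>_. x)"
    using push[OF homotopic_paths_linv[OF id(1,2)]] by (simp add: id path_compose_join)
qed

lemma group_fundamental_group:
  assumes x: "x \<in> S"
  shows "group (fundamental_group S x)"
proof (rule groupI)
  let ?G = "fundamental_group S x"
  have car: "carrier ?G = path_class S ` loops S x" and one: "\<one>\<^bsub>?G\<^esub> = path_class S (\<lambda>_. x)"
    by (simp_all add: fundamental_group_def)
  show "\<one>\<^bsub>?G\<^esub> \<in> carrier ?G"
    using loops_const[OF x] by (simp add: car one)
  show "A \<otimes>\<^bsub>?G\<^esub> B \<in> carrier ?G" if "A \<in> carrier ?G" "B \<in> carrier ?G" for A B
    using that by (auto simp: car fundamental_group_mult loops_join)
  show "A \<otimes>\<^bsub>?G\<^esub> B \<otimes>\<^bsub>?G\<^esub> C = A \<otimes>\<^bsub>?G\<^esub> (B \<otimes>\<^bsub>?G\<^esub> C)"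
    if "A \<in> carrier ?G" "B \<in> carrier ?G" "C \<in> carrier ?G" for A B C
  proof -
    obtain p where p: "p \<in> loops S x" "A = path_class S p"
      using \<open>A \<in> carrier ?G\<close> by (auto simp: car)
    obtain q where q: "q \<in> loops S x" "B = path_class S q"
      using \<open>B \<in> carrier ?G\<close> by (auto simp: car)
    obtain r where r: "r \<in> loops S x" "C = path_class S r"
      using \<open>C \<in> carrier ?G\<close> by (auto simp: car)
    have "homotopic_paths S (p +++ (q +++ r)) ((p +++ q) +++ r)"
      using p q r by (intro homotopic_paths_assoc) (auto simp: loops_def)
    then have "path_class S (p +++ (q +++ r)) = path_class S ((p +++ q) +++ r)"
      using path_class_eq_iff[OF loops_join[OF p(1) loops_join[OF q(1) r(1)]]] by blast
    then show ?thesis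
      using p q r by (simp add: fundamental_group_mult loops_join)
  qed
  show "\<one>\<^bsub>?G\<^esub> \<otimes>\<^bsub>?G\<^esub> A = A" if "A \<in> carrier ?G" for A
  proof -
    obtain p where p: "p \<in> loops S x" "A = path_class S p"
      using \<open>A \<in> carrier ?G\<close> by (auto simp: car)
    then show ?thesis
      using homotopic_loops_lid[OF p(1)] path_class_eq_iff[of "(\<lambda>_. x) +++ p" S x] loops_const[OF x]
      by (simp add: one fundamental_group_mult loops_join)
  qed
  show "\<exists>B\<in>carrier ?G. B \<otimes>\<^bsub>?G\<^esub> A = \<one>\<^bsub>?G\<^esub>" if "A \<in> carrier ?G" for A
  proof -
    obtain p where p: "p \<in> loops S x" "A = path_class S p"
      using \<open>A \<in> carrier ?G\<close> by (auto simp: car)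
    then have "path_class S (reversepath p) \<otimes>\<^bsub>?G\<^esub> A = \<one>\<^bsub>?G\<^esub>"
      using homotopic_loops_linv[OF p(1)] path_class_eq_iff[of "reversepath p +++ p" S x]
      by (simp add: one fundamental_group_mult loops_join loops_reversepath)
    then show ?thesis
      using p loops_reversepath[OF p(1)] by (auto simp: car)
  qed
qed

subsection \<open>Surfaces\<close>

text \<open>Second countability is omitted because it follows from compactness.\<close>

definition closed_surface :: "'a topology \<Rightarrow> bool" where
  "closed_surface Y \<longleftrightarrow> compact_space Y \<and> Hausdorff_space Y \<and>
     (\<forall>x\<in>topspace Y. \<exists>U. openin Y U \<and> x \<in> U \<and> subtopology Y U homeomorphic_space Euclidean_space 2)"

text \<open>An orientation of a closed surface, given as a fundamental class: a class in \<open>H\<^sub>2(Y)\<close> that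
  restricts to a generator of the local homology group \<open>H\<^sub>2(Y, Y - {x})\<close> at every point \<open>x\<close>.\<close>

definition surface_orientation :: "'a topology \<Rightarrow> 'a chain set \<Rightarrow> bool" where
  "surface_orientation Y \<mu> \<longleftrightarrow> \<mu> \<in> carrier (homology_group 2 Y) \<and>
     (\<forall>x\<in>topspace Y.
        generate (relative_homology_group 2 Y (topspace Y - {x}))
          {hom_induced 2 Y {} Y (topspace Y - {x}) id \<mu>}
        = carrier (relative_homology_group 2 Y (topspace Y - {x})))"

text \<open>The genus of a closed, connected, oriented surface is half its first Betti number.\<close>

definition has_genus :: "'a topology \<Rightarrow> nat \<Rightarrow> bool" where
  "has_genus Y g \<longleftrightarrow> homology_group 1 Y \<cong> free_Abelian_group {..<2 * g}"

definition commutator :: "('a, 'b) monoid_scheme \<Rightarrow> 'a \<Rightarrow> 'a \<Rightarrow> 'a" where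
  "commutator G a b = a \<otimes>\<^bsub>G\<^esub> b \<otimes>\<^bsub>G\<^esub> inv\<^bsub>G\<^esub> a \<otimes>\<^bsub>G\<^esub> inv\<^bsub>G\<^esub> b"

text \<open>Generators \<open>\<alpha> 0, \<beta> 0, \<dots>, \<alpha> (g-1), \<beta> (g-1)\<close> subject to
  \<open>[\<alpha> 0, \<beta> 0] \<cdots> [\<alpha> (g-1), \<beta> (g-1)] = 1\<close>. For the fundamental group of a closed oriented surface of
  genus \<open>g\<close> this is automatically a presentation: the elements define a surjection from the
  one-relator surface group onto an isomorphic group, and surface groups are Hopfian.\<close>

definition standard_generators ::
  "('a, 'b) monoid_scheme \<Rightarrow> nat \<Rightarrow> (nat \<Rightarrow> 'a) \<Rightarrow> (nat \<Rightarrow> 'a) \<Rightarrow> bool" where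
  "standard_generators G g \<alpha> \<beta> \<longleftrightarrow>
     \<alpha> ` {..<g} \<union> \<beta> ` {..<g} \<subseteq> carrier G \<and>
     generate G (\<alpha> ` {..<g} \<union> \<beta> ` {..<g}) = carrier G \<and>
     foldr (\<lambda>l y. commutator G (\<alpha> l) (\<beta> l) \<otimes>\<^bsub>G\<^esub> y) [0..<g] \<one>\<^bsub>G\<^esub> = \<one>\<^bsub>G\<^esub>"

subsection \<open>The torus\<close>

definition circle_group :: "complex monoid" where
  "circle_group = \<lparr>carrier = sphere 0 1, monoid.mult = (*), one = 1\<rparr>"

definition torus_group :: "nat \<Rightarrow> (nat \<Rightarrow> complex) monoid" where
  "torus_group n = product_group {..<n} (\<lambda>_. circle_group)"

definition torus_topology :: "nat \<Rightarrow> (nat \<Rightarrow> complex) topology" where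
  "torus_topology n = product_topology (\<lambda>_. top_of_set (sphere 0 1)) {..<n}"

lemma topspace_torus: "topspace (torus_topology n) = carrier (torus_group n)"
  by (simp add: torus_topology_def torus_group_def circle_group_def)

text \<open>Indices start at 0, so column \<open>2 * l\<close> belongs to \<open>\<alpha> l\<close> and column \<open>2 * l + 1\<close> to \<open>\<beta> l\<close>.\<close>

definition angle_matrix ::
  "nat \<Rightarrow> nat \<Rightarrow> (nat \<Rightarrow> 'b) \<Rightarrow> (nat \<Rightarrow> 'b) \<Rightarrow> ('b \<Rightarrow> nat \<Rightarrow> complex) \<Rightarrow> real mat" where
  "angle_matrix n g \<alpha> \<beta> \<rho> =
     Matrix.mat n (2 * g)
       (\<lambda>(i, j). Arg2pi (\<rho> (if even j then \<alpha> (j div 2) else \<beta> (j div 2)) i))"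

lemma angle_matrix_entries:
  assumes "i < n" "l < g" "\<rho> (\<alpha> l) \<in> carrier (torus_group n)" "\<rho> (\<beta> l) \<in> carrier (torus_group n)"
  shows "angle_matrix n g \<alpha> \<beta> \<rho> $$ (i, 2 * l) \<in> {0..<2 * pi}"
    and "angle_matrix n g \<alpha> \<beta> \<rho> $$ (i, 2 * l + 1) \<in> {0..<2 * pi}"
    and "exp (\<i> * of_real (angle_matrix n g \<alpha> \<beta> \<rho> $$ (i, 2 * l))) = \<rho> (\<alpha> l) i"
    and "exp (\<i> * of_real (angle_matrix n g \<alpha> \<beta> \<rho> $$ (i, 2 * l + 1))) = \<rho> (\<beta> l) i"
proof -
  have arg: "Arg2pi z \<in> {0..<2 * pi}" "exp (\<i> * of_real (Arg2pi z)) = z" if z: "norm z = 1" for z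
  proof -
    have "z = of_real (norm z) * exp (\<i> * of_real (Arg2pi z))"
      using Arg2pi[of z] unfolding is_Arg_def by blast
    with z show "exp (\<i> * of_real (Arg2pi z)) = z"
      by (metis mult_1 of_real_1)
    show "Arg2pi z \<in> {0..<2 * pi}"
      using Arg2pi[of z] by (meson atLeastLessThan_iff)
  qed
  have norm: "norm (\<rho> (\<alpha> l) i) = 1" "norm (\<rho> (\<beta> l) i) = 1"
    using assms(1) assms(3,4)[unfolded torus_group_def circle_group_def] by (auto simp: PiE_iff)
  have entries: "angle_matrix n g \<alpha> \<beta> \<rho> $$ (i, 2 * l) = Arg2pi (\<rho> (\<alpha> l) i)"
    "angle_matrix n g \<alpha> \<beta> \<rho> $$ (i, 2 * l + 1) = Arg2pi (\<rho> (\<beta> l) i)"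
    using assms(1,2) by (simp_all add: angle_matrix_def)
  show "angle_matrix n g \<alpha> \<beta> \<rho> $$ (i, 2 * l) \<in> {0..<2 * pi}"
    "exp (\<i> * of_real (angle_matrix n g \<alpha> \<beta> \<rho> $$ (i, 2 * l))) = \<rho> (\<alpha> l) i"
    unfolding entries by (rule arg[OF norm(1)])+
  show "angle_matrix n g \<alpha> \<beta> \<rho> $$ (i, 2 * l + 1) \<in> {0..<2 * pi}"
    "exp (\<i> * of_real (angle_matrix n g \<alpha> \<beta> \<rho> $$ (i, 2 * l + 1))) = \<rho> (\<beta> l) i"
    unfolding entries by (rule arg[OF norm(2)])+
qed

subsection \<open>The module generated by the rows of a matrix\<close>

text \<open>\<open>\<int>\<close>-modules are treated as abelian groups, so the generated module is the generated subgroup.\<close>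

definition int_row_module :: "real mat \<Rightarrow> real Matrix.vec monoid" where
  "int_row_module M = subgroup_generated (monoid_vec TYPE(real) (dim_col M)) (set (Matrix.rows M))"

definition int_independent :: "('a, 'b) monoid_scheme \<Rightarrow> 'a set \<Rightarrow> bool" where
  "int_independent G B \<longleftrightarrow> finite B \<and> B \<subseteq> carrier G \<and>
     (\<forall>c :: 'a \<Rightarrow> int. finprod G (\<lambda>b. b [^]\<^bsub>G\<^esub> c b) B = \<one>\<^bsub>G\<^esub> \<longrightarrow> (\<forall>b\<in>B. c b = 0))"

text \<open>The maximum exists for finitely generated groups, the only ones for which it is used.\<close>

definition int_rank :: "('a, 'b) monoid_scheme \<Rightarrow> nat" where
  "int_rank G = Max {card B | B. int_independent G B}"

definition int_row_rank :: "real mat \<Rightarrow> nat" where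
  "int_row_rank M = int_rank (int_row_module M)"

definition pi_rat_vecs :: "nat \<Rightarrow> real Matrix.vec set" where
  "pi_rat_vecs d = {v \<in> carrier_vec d. \<forall>i<d. \<exists>q\<in>\<rat>. vec_index v i = pi * q}"

definition pi_rat_free_rows :: "real mat \<Rightarrow> bool" where
  "pi_rat_free_rows M \<longleftrightarrow>
     carrier (int_row_module M) \<inter> pi_rat_vecs (dim_col M) = {0\<^sub>v (dim_col M)}"

end

theory Submission
  imports Defs "HOL-Real_Asymp.Real_Asymp"
begin

text \<open>A homomorphism into the torus has dense image iff no nontrivial character
  \<open>z \<mapsto> \<Prod>i. z\<^sub>i^(m\<^sub>i)\<close> is trivial on it. If the image missed a neighbourhood of some point \<open>y\<close>,
  the trigonometric polynomial \<open>\<Prod>i. (1 + w\<^sub>i)^(2p) w\<^sub>i^(-p)\<close> with \<open>w\<^sub>i = z\<^sub>i / y\<^sub>i\<close> would be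
  exponentially smaller on the image than its maximum \<open>4^(pn)\<close>, while its constant term is
  \<open>(2p choose p)^n\<close>, smaller than \<open>4^(pn)\<close> only by a factor polynomial in \<open>p\<close>; but averaging over
  the group kills every nontrivial character, so the constant term is bounded by the supremum
  over the image. On the generators, triviality of the character \<open>m\<close> says that \<open>m\<Theta>\<close> has entries in
  \<open>2\<pi>\<int>\<close>; clearing denominators, this happens for some \<open>m \<noteq> 0\<close> iff \<open>m\<Theta>\<close> has entries in \<open>\<pi>\<rat>\<close> for
  some \<open>m \<noteq> 0\<close>, which is what the rank condition and the freeness condition exclude together.\<close>

subsection \<open>Characters and density in the torus\<close>

text \<open>Characters are removed one at a time, by averaging over the powers of an element on which the
  character is not \<open>1\<close>.\<close>

lemma (in group) norm_const_term_le:
  fixes ch :: "'i \<Rightarrow> 'a \<Rightarrow> complex" and c :: "'i \<Rightarrow> complex" and c0 :: complex and B :: real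
  assumes "finite A"
    and "\<And>a x y. a \<in> A \<Longrightarrow> x \<in> carrier G \<Longrightarrow> y \<in> carrier G \<Longrightarrow> ch a (x \<otimes> y) = ch a x * ch a y"
    and "\<And>a x. a \<in> A \<Longrightarrow> x \<in> carrier G \<Longrightarrow> norm (ch a x) = 1"
    and "\<And>a. a \<in> A \<Longrightarrow> \<exists>x\<in>carrier G. ch a x \<noteq> 1"
    and "\<And>x. x \<in> carrier G \<Longrightarrow> norm (c0 + (\<Sum>a\<in>A. c a * ch a x)) \<le> B"
  shows "norm c0 \<le> B"
  using assms
proof (induction A arbitrary: c B rule: finite_induct)
  case empty
  then show ?case using one_closed by force
next
  case (insert a A)
  note mult = insert.prems(1) and norm1 = insert.prems(2) and nontriv = insert.prems(3)
    and bound = insert.prems(4)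
  obtain h where h: "h \<in> carrier G" "ch a h \<noteq> 1"
    using nontriv by blast
  have ch_pow: "ch b (x \<otimes> h [^] j) = ch b x * ch b h ^ j"
    if "b \<in> insert a A" "x \<in> carrier G" for b x and j :: nat
  proof (induction j)
    case 0
    then show ?case using that by simp
  next
    case (Suc j)
    have "x \<otimes> h [^] Suc j = (x \<otimes> h [^] j) \<otimes> h"
      using that h by (simp add: m_assoc)
    then have "ch b (x \<otimes> h [^] Suc j) = ch b (x \<otimes> h [^] j) * ch b h"
      using that h by (simp only: mult m_closed nat_pow_closed)
    then show ?case
      using Suc by simp
  qed
  \<comment> \<open>Averaging over the translates \<open>x \<otimes> h [^] j\<close> with
    \<open>j < N\<close> multiplies the coefficient of \<open>ch b\<close> by this mean of a
    geometric progression and leaves \<open>c0\<close> unchanged.\<close>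
  define lam where "lam N b = (\<Sum>j<N. ch b h ^ j) / of_nat N" for N :: nat and b
  \<comment> \<open>For finite \<open>N\<close> the term of \<open>a\<close> is damped but not
    removed, so its size is moved into the bound. This is why the induction leaves both
    \<open>c\<close> and \<open>B\<close> arbitrary.\<close>
  have key: "norm c0 \<le> B + norm (c a * lam N a)" if N: "N > 0" for N
  proof (rule insert.IH[of "\<lambda>b. c b * lam N b"])
    fix x assume x: "x \<in> carrier G"
    define F where "F = (\<lambda>x. c0 + (\<Sum>b\<in>insert a A. c b * ch b x))"
    have "(\<Sum>j<N. F (x \<otimes> h [^] j))
        = of_nat N * c0 + (\<Sum>b\<in>insert a A. \<Sum>j<N. c b * ch b x * ch b h ^ j)"
      unfolding F_def by (subst sum.swap) (simp add: sum.distrib ch_pow x mult.assoc)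
    also have "(\<Sum>b\<in>insert a A. \<Sum>j<N. c b * ch b x * ch b h ^ j)
        = of_nat N * (\<Sum>b\<in>insert a A. c b * lam N b * ch b x)"
      unfolding sum_distrib_left using N
      by (intro sum.cong) (auto simp: lam_def sum_distrib_left[symmetric] field_simps)
    finally have avg: "(\<Sum>j<N. F (x \<otimes> h [^] j))
        = of_nat N * (c0 + (\<Sum>b\<in>insert a A. c b * lam N b * ch b x))"
      by (simp only: distrib_left)
    have "norm (\<Sum>j<N. F (x \<otimes> h [^] j)) \<le> of_nat (card {..<N}) * B"
      unfolding F_def using x h by (intro sum_norm_bound bound) auto
    then have "norm (c0 + (\<Sum>b\<in>insert a A. c b * lam N b * ch b x)) \<le> B"
      unfolding avg norm_mult using N by simp
    moreover have "c0 + (\<Sum>b\<in>A. c b * lam N b * ch b x)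
        = (c0 + (\<Sum>b\<in>insert a A. c b * lam N b * ch b x)) - c a * lam N a * ch a x"
      using insert.hyps by simp
    moreover have "norm (c a * lam N a * ch a x) = norm (c a * lam N a)"
      using norm1[of a x] x by (simp add: norm_mult)
    ultimately show "norm (c0 + (\<Sum>b\<in>A. c b * lam N b * ch b x)) \<le> B + norm (c a * lam N a)"
      by (smt (verit) norm_triangle_ineq4)
  qed (use mult norm1 nontriv in auto)
  \<comment> \<open>Since \<open>ch a h \<noteq> 1\<close>, the geometric sums stay below
    \<open>2 / norm (1 - ch a h)\<close>; the damped term is therefore O(1/N) and disappears in the
    limit.\<close>
  define K where "K = 2 * norm (c a) / norm (1 - ch a h)"
  have lam_le: "norm (c a * lam N a) \<le> K / real N" for N
  proof -
    have "norm (1 - ch a h ^ N) \<le> 2"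
      using norm_triangle_ineq4[of 1 "ch a h ^ N"] norm1[of a h] h by (simp add: norm_power)
    then have "norm (1 - ch a h ^ N) / norm (1 - ch a h) \<le> 2 / norm (1 - ch a h)"
      by (intro divide_right_mono) auto
    then have "norm (\<Sum>j<N. ch a h ^ j) \<le> 2 / norm (1 - ch a h)"
      using h by (simp add: sum_gp_strict norm_divide)
    then have "norm (c a) * norm (\<Sum>j<N. ch a h ^ j) / real N
        \<le> norm (c a) * (2 / norm (1 - ch a h)) / real N"
      by (intro divide_right_mono mult_left_mono) auto
    then show ?thesis
      by (simp add: lam_def K_def norm_mult norm_divide mult_ac)
  qed
  have "(\<lambda>N. B + K / real N) \<longlonglongrightarrow> B + 0"
    by (intro tendsto_add tendsto_const lim_const_over_n)
  moreover have "\<exists>N0. \<forall>N\<ge>N0. norm c0 \<le> B + K / real N"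
    using key lam_le by (intro exI[of _ 1]) (smt (verit) less_eq_Suc_le One_nat_def)
  ultimately have "norm c0 \<le> B + 0"
    by (rule LIMSEQ_le_const)
  then show ?case by simp
qed

text \<open>Lets triviality of a character be tested on generators. As \<open>f\<close> does not
  vanish, \<open>f \<one> = f \<one> * f \<one>\<close> forces \<open>f \<one> = 1\<close>, and
  induction over \<open>generate\<close> does the rest.\<close>

lemma (in group) multiplicative_eq_1_on_generators:
  fixes f :: "'a \<Rightarrow> 'k::field"
  assumes mult: "\<And>x y. x \<in> carrier G \<Longrightarrow> y \<in> carrier G \<Longrightarrow> f (x \<otimes> y) = f x * f y"
    and nz: "\<And>x. x \<in> carrier G \<Longrightarrow> f x \<noteq> 0"
    and S: "S \<subseteq> carrier G" and gen: "generate G S = carrier G"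
    and one: "\<And>s. s \<in> S \<Longrightarrow> f s = 1" and x: "x \<in> carrier G"
  shows "f x = 1"
proof -
  have f1: "f \<one> = 1"
    using mult[of \<one> \<one>] nz[of \<one>] by simp
  have "x \<in> generate G S"
    using x gen by simp
  then show ?thesis
  proof induction
    case (inv h)
    then have "f h * f (inv h) = 1"
      using S mult[of h "inv h"] f1 by auto
    then show ?case using one[OF inv] by simp
  next
    case (eng h1 h2)
    then show ?case using S mult gen by simp
  qed (use f1 one in auto)
qed

section \<open>Characters of the torus\<close>

definition torus_char :: "nat \<Rightarrow> (nat \<Rightarrow> int) \<Rightarrow> (nat \<Rightarrow> complex) \<Rightarrow> complex" where
  "torus_char n m z = (\<Prod>i<n. z i powi m i)"

lemma carrier_torus_group: "carrier (torus_group n) = (\<Pi>\<^sub>E i\<in>{..<n}. sphere 0 1)"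
  by (simp add: torus_group_def circle_group_def)

lemma norm_torus_component: "z \<in> carrier (torus_group n) \<Longrightarrow> i < n \<Longrightarrow> norm (z i) = 1"
  by (auto simp: carrier_torus_group PiE_iff)

lemma torus_char_mult:
  "torus_char n m (z \<otimes>\<^bsub>torus_group n\<^esub> w) = torus_char n m z * torus_char n m w"
  by (simp add: torus_char_def torus_group_def circle_group_def power_int_mult_distrib
      prod.distrib)

lemma norm_torus_char: "z \<in> carrier (torus_group n) \<Longrightarrow> norm (torus_char n m z) = 1"
  by (auto simp: torus_char_def prod_norm[symmetric] norm_power_int norm_torus_component
      intro!: prod.neutral)

lemma continuous_map_torus_char:
  "continuous_map (torus_topology n) euclidean (torus_char n m)"
proof -
  have "continuous_map (torus_topology n) euclidean (\<lambda>z. z i powi m i)" if "i < n" for i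
  proof -
    have "continuous_map (torus_topology n) (top_of_set (sphere 0 1)) (\<lambda>z. z i)"
      unfolding torus_topology_def using that by (intro continuous_map_product_projection) auto
    \<comment> \<open>The circle misses 0, so negative exponents are harmless.\<close>
    moreover have "continuous_on (sphere 0 1) (\<lambda>w::complex. w powi m i)"
      by (intro continuous_intros) auto
    then have "continuous_map (top_of_set (sphere 0 1)) euclidean (\<lambda>w::complex. w powi m i)"
      by simp
    ultimately have "continuous_map (torus_topology n) euclidean ((\<lambda>w. w powi m i) \<circ> (\<lambda>z. z i))"
      by (rule continuous_map_compose)
    then show ?thesis
      by (simp only: o_def)
  qed
  then show ?thesis
    unfolding torus_char_def continuous_map_atin by (auto intro!: tendsto_prod)
qed

lemma exists_torus_char_neq_1:
  assumes "k < n" "m k \<noteq> 0"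
  shows "\<exists>z\<in>carrier (torus_group n). torus_char n m z \<noteq> 1"
proof
  \<comment> \<open>With every other coordinate equal to 1, this angle gives the character the value
    exp(i pi) = -1.\<close>
  define t where "t = pi / real_of_int (m k)"
  define z where "z = (\<lambda>i\<in>{..<n}. if i = k then exp (\<i> * of_real t) else 1)"
  show "z \<in> carrier (torus_group n)"
    by (auto simp: carrier_torus_group z_def)
  have "torus_char n m z = (\<Prod>i<n. if i = k then exp (\<i> * of_real t) powi m k else 1)"
    unfolding torus_char_def by (intro prod.cong) (auto simp: z_def)
  also have "\<dots> = exp (of_int (m k) * (\<i> * of_real t))"
    using assms by (simp add: exp_power_int)
  also have "of_int (m k) * (\<i> * of_real t) = \<i> * of_real (real_of_int (m k) * t)"
    by simp
  also have "real_of_int (m k) * t = pi"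
    using assms by (simp add: t_def)
  finally show "torus_char n m z \<noteq> 1"
    by simp
qed

section \<open>Size of the test polynomial\<close>

lemma binomial_Laurent:
  fixes z :: complex
  assumes "z \<noteq> 0"
  shows "(\<Sum>k\<le>2 * p. of_nat (2 * p choose k) * z powi (int k - int p))
    = (1 + z) ^ (2 * p) * z powi (- int p)"
proof -
  have "(1 + z) ^ (2 * p) = (\<Sum>k\<le>2 * p. of_nat (2 * p choose k) * z ^ k)"
    using binomial_ring[of z 1 "2 * p"] by (simp add: add.commute)
  moreover have "z powi (int k - int p) = z ^ k * z powi (- int p)" for k
    using assms by (simp add: power_int_diff power_int_minus field_simps)
  ultimately show ?thesis
    by (simp add: sum_distrib_right mult.assoc)
qed

text \<open>The parallelogram law for \<open>1\<close> and \<open>z\<close>. It turns distance of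
  \<open>z\<close> from 1 into a loss against the maximal value 4.\<close>

lemma norm_one_plus_power2:
  fixes z :: complex
  assumes "norm z = 1"
  shows "norm (1 + z) ^ 2 = 4 - norm (z - 1) ^ 2"
proof -
  have "Re z ^ 2 + Im z ^ 2 = 1"
    using assms by (metis cmod_power2 one_power2)
  then show ?thesis
    unfolding cmod_power2 by (simp add: power2_eq_square algebra_simps)
qed

text \<open>The decay \<open>q ^ p\<close> comes from missing a neighbourhood, the power of
  \<open>2 * real p\<close> from the central binomial coefficients; the decay wins.\<close>

lemma poly_times_geometric_tendsto_0:
  fixes q :: real
  assumes "0 < q" "q < 1"
  shows "(\<lambda>p. (2 * real p) ^ n * q ^ p) \<longlonglongrightarrow> 0"
proof -
  have "ln q < 0" using assms by simp
  then have "(\<lambda>p. (2 * real p) powr real n * exp (ln q * real p)) \<longlonglongrightarrow> 0"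
    by real_asymp
  moreover have "eventually (\<lambda>p. (2 * real p) powr real n * exp (ln q * real p) = (2 * real p) ^ n * q ^ p) sequentially"
    using eventually_gt_at_top[of 0]
  proof eventually_elim
    case (elim p)
    then show ?case
      using assms by (simp add: powr_realpow exp_of_nat2_mult)
  qed
  ultimately show ?thesis
    using tendsto_cong by force
qed


section \<open>Density of homomorphic images in the torus\<close>

lemma (in group) torus_orbit_approximates:
  assumes hom: "\<rho> \<in> hom G (torus_group n)"
    and nontriv: "\<And>m. \<exists>i<n. m i \<noteq> 0 \<Longrightarrow> \<exists>x\<in>carrier G. torus_char n m (\<rho> x) \<noteq> 1"
    and y: "y \<in> carrier (torus_group n)" and \<delta>: "\<delta> > 0"
  shows "\<exists>x\<in>carrier G. \<forall>i<n. norm (\<rho> x i - y i) < \<delta>"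
proof (rule ccontr)
  assume not_near: "\<not> ?thesis"
  \<comment> \<open>Here \<open>q\<close> is (4 - d^2)/4, the factor lost by
    \<open>norm (1 + w) ^ 2\<close> against its maximum 4 once \<open>w\<close> on the circle is at
    distance at least \<open>d\<close> from 1. Capping \<open>d\<close> at 1 keeps \<open>q\<close>
    positive.\<close>
  define d where "d = min \<delta> 1"
  define q where "q = 1 - d ^ 2 / 4"
  have d: "0 < d" "d \<le> 1" "d \<le> \<delta>"
    using \<delta> by (auto simp: d_def)
  have q: "0 < q" "q < 1"
    using d power_le_one[of d 2] by (auto simp: q_def)
  have far: "\<exists>i<n. norm (\<rho> x i - y i) \<ge> d" if "x \<in> carrier G" for x
    using not_near that d by (meson not_less order_trans)
  have \<rho>: "\<rho> x \<in> carrier (torus_group n)" if "x \<in> carrier G" for x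
    using hom that by (auto simp: hom_def)
  have ge1: "1 \<le> (2 * real p) ^ n * q ^ p" if p: "p > 0" for p
  proof -
    \<comment> \<open>In the expanded product of \<open>n\<close> Laurent polynomials,
      \<open>g\<close> picks the summand of index \<open>g i\<close>, hence exponent
      \<open>e g i\<close>, from the \<open>i\<close>-th factor. \<open>g0\<close> picks exponent 0
      throughout, so \<open>c g0\<close> is the constant term. The powers of
      \<open>cnj (y i)\<close> carry the translation by \<open>y\<close>.\<close>
    define A where "A = (\<Pi>\<^sub>E i\<in>{..<n}. {..2 * p})"
    define g0 where "g0 = (\<lambda>i\<in>{..<n}. p)"
    define e :: "(nat \<Rightarrow> nat) \<Rightarrow> nat \<Rightarrow> int" where "e = (\<lambda>g i. int (g i) - int p)"
    define c where "c g = (\<Prod>i<n. of_nat (2 * p choose g i) * cnj (y i) powi e g i)" for g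
    have fin: "finite A" and g0: "g0 \<in> A"
      by (auto simp: A_def g0_def intro!: finite_PiE)
    have c_g0: "c g0 = of_nat (2 * p choose p) ^ n"
      by (simp add: c_def g0_def e_def)
    have "norm (c g0) \<le> (4 ^ p) ^ n * q ^ p"
    proof (rule norm_const_term_le[where A = "A - {g0}" and ch = "\<lambda>g x. torus_char n (e g) (\<rho> x)" and c = c])
      show "\<exists>x\<in>carrier G. torus_char n (e g) (\<rho> x) \<noteq> 1" if "g \<in> A - {g0}" for g
      proof (rule nontriv)
        \<comment> \<open>Members of \<open>A\<close> are extensional, so two different ones already
          differ below \<open>n\<close>.\<close>
        have "\<exists>i<n. g i \<noteq> g0 i"
          using that g0 unfolding A_def by (metis DiffE PiE_ext insertI1 lessThan_iff)
        then show "\<exists>i<n. e g i \<noteq> 0"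
          by (auto simp: e_def g0_def)
      qed
      show "torus_char n (e g) (\<rho> (x \<otimes> x')) = torus_char n (e g) (\<rho> x) * torus_char n (e g) (\<rho> x')"
        if "x \<in> carrier G" "x' \<in> carrier G" for g x x'
        using hom_mult[OF hom that] by (simp add: torus_char_mult)
      show "norm (c g0 + (\<Sum>g\<in>A - {g0}. c g * torus_char n (e g) (\<rho> x))) \<le> (4 ^ p) ^ n * q ^ p"
        if x: "x \<in> carrier G" for x
      proof -
        \<comment> \<open>On the unit circle \<open>cnj (y i)\<close> is the inverse of
          \<open>y i\<close>, so this is the ratio of \<open>\<rho> x i\<close> to
          \<open>y i\<close>.\<close>
        define z where "z i = \<rho> x i * cnj (y i)" for i
        have z1: "norm (z i) = 1" if "i < n" for i
          using that norm_torus_component[OF y] norm_torus_component[OF \<rho>[OF x]]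
          by (simp add: z_def norm_mult)
        have zy: "norm (z i - 1) = norm (\<rho> x i - y i)" if "i < n" for i
        proof -
          have "y i * cnj (y i) = 1"
            using norm_torus_component[OF y that] by (simp add: complex_norm_square[symmetric])
          then have "z i - 1 = (\<rho> x i - y i) * cnj (y i)"
            by (simp add: z_def algebra_simps)
          then show ?thesis
            using norm_torus_component[OF y that] by (simp add: norm_mult)
        qed
        have "torus_char n (e g0) (\<rho> x) = 1"
          by (simp add: torus_char_def e_def g0_def)
        then have "c g0 + (\<Sum>g\<in>A - {g0}. c g * torus_char n (e g) (\<rho> x))
            = (\<Sum>g\<in>A. c g * torus_char n (e g) (\<rho> x))"
          using fin g0 by (simp add: sum.remove[of A g0])
        also have "\<dots> = (\<Sum>g\<in>A. \<Prod>i<n. of_nat (2 * p choose g i) * z i powi e g i)"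
          by (simp add: c_def torus_char_def z_def power_int_mult_distrib prod.distrib mult_ac)
        also have "\<dots> = (\<Prod>i<n. \<Sum>k\<le>2 * p. of_nat (2 * p choose k) * z i powi (int k - int p))"
          unfolding A_def e_def by (rule prod_sum_PiE[symmetric]) auto
        also have "\<dots> = (\<Prod>i<n. (1 + z i) ^ (2 * p) * z i powi (- int p))"
          using z1 by (intro prod.cong refl binomial_Laurent) force
        finally have "norm (c g0 + (\<Sum>g\<in>A - {g0}. c g * torus_char n (e g) (\<rho> x)))
            = (\<Prod>i<n. (norm (1 + z i) ^ 2) ^ p)"
          using z1 by (simp add: prod_norm[symmetric] norm_mult norm_power norm_power_int power_mult)
        \<comment> \<open>In coordinate \<open>l\<close> the point \<open>\<rho> x\<close> stays
          away from \<open>y\<close>: that factor gains \<open>q ^ p\<close>, and every other one is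
          bounded by \<open>4 ^ p\<close>.\<close>
        also obtain l where l: "l < n" "norm (\<rho> x l - y l) \<ge> d"
          using far[OF x] by blast
        have "(\<Prod>i<n. (norm (1 + z i) ^ 2) ^ p) \<le> (\<Prod>i<n. 4 ^ p * (if i = l then q ^ p else 1))"
        proof (intro prod_mono conjI)
          fix i assume i: "i \<in> {..<n}"
          have "norm (1 + z i) ^ 2 \<le> 4 * (if i = l then q else 1)"
          proof (cases "i = l")
            case True
            have "d ^ 2 \<le> norm (z l - 1) ^ 2"
              using l d zy[of l] by (intro power_mono) auto
            then show ?thesis
              using True l norm_one_plus_power2[OF z1[of l]] by (simp add: q_def)
          next
            case False
            then show ?thesis
              using i norm_one_plus_power2[OF z1[of i]] by simp
          qed
          then have "(norm (1 + z i) ^ 2) ^ p \<le> (4 * (if i = l then q else 1)) ^ p"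
            by (rule power_mono) simp
          then show "(norm (1 + z i) ^ 2) ^ p \<le> 4 ^ p * (if i = l then q ^ p else 1)"
            by (simp add: power_mult_distrib split: if_splits)
        qed simp
        also have "\<dots> = (4 ^ p) ^ n * q ^ p"
          using l by (simp add: prod.distrib)
        finally show ?thesis .
      qed
    qed (use fin \<rho> norm_torus_char in auto)
    then have "real (2 * p choose p) ^ n \<le> (4 ^ p) ^ n * q ^ p"
      by (simp add: c_g0 norm_power)
    \<comment> \<open>The central binomial coefficient is at least
      \<open>4 ^ p / (2 * real p)\<close>; cancelling \<open>(4 ^ p) ^ n\<close> then leaves the
      claimed inequality.\<close>
    moreover have "(4 ^ p / (2 * real p)) ^ n \<le> real (2 * p choose p) ^ n"
      using central_binomial_lower_bound[OF p] by (intro power_mono) auto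
    ultimately have "(4 ^ p) ^ n / (2 * real p) ^ n \<le> (4 ^ p) ^ n * q ^ p"
      by (simp add: power_divide)
    then have "(4 ^ p) ^ n * 1 \<le> (4 ^ p) ^ n * ((2 * real p) ^ n * q ^ p)"
      using p by (simp add: divide_le_eq mult_ac)
    then show ?thesis
      by (subst (asm) mult_le_cancel_left_pos) auto
  qed
  have "(1::real) \<le> 0"
    using poly_times_geometric_tendsto_0[OF q] ge1
    by (intro LIMSEQ_le_const[of "\<lambda>p. (2 * real p) ^ n * q ^ p"] exI[of _ 1]) auto
  then show False by simp
qed

text \<open>A nontrivial character that is trivial on the image confines it to a proper closed
  subset, the kernel. Conversely, simultaneous approximation in all coordinates reaches every basic
  open box.\<close>

lemma (in group) hom_torus_dense_iff:
  assumes hom: "\<rho> \<in> hom G (torus_group n)"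
  shows "torus_topology n closure_of (\<rho> ` carrier G) = topspace (torus_topology n)
    \<longleftrightarrow> (\<forall>m. (\<exists>i<n. m i \<noteq> 0) \<longrightarrow> (\<exists>x\<in>carrier G. torus_char n m (\<rho> x) \<noteq> 1))"
    (is "?dense \<longleftrightarrow> ?nontriv")
proof
  have img: "\<rho> ` carrier G \<subseteq> topspace (torus_topology n)"
    using hom by (auto simp: hom_def topspace_torus)
  show ?nontriv if dense: ?dense
  proof (intro allI impI, rule ccontr)
    fix m assume "\<exists>i<n. m i \<noteq> 0" and triv: "\<not> (\<exists>x\<in>carrier G. torus_char n m (\<rho> x) \<noteq> 1)"
    then obtain z where z: "z \<in> topspace (torus_topology n)" "torus_char n m z \<noteq> 1"
      using exists_torus_char_neq_1 topspace_torus by metis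
    define C where "C = {z \<in> topspace (torus_topology n). torus_char n m z \<in> {1}}"
    have "closedin (torus_topology n) C"
      unfolding C_def by (rule closedin_continuous_map_preimage[OF continuous_map_torus_char]) simp
    moreover have "\<rho> ` carrier G \<subseteq> C"
      using triv img by (auto simp: C_def)
    ultimately have "topspace (torus_topology n) \<subseteq> C"
      using closure_of_minimal dense by metis
    then show False
      using z by (auto simp: C_def)
  qed
  show ?dense if nontriv: ?nontriv
  proof (intro antisym closure_of_subset_topspace subsetI)
    fix y assume y: "y \<in> topspace (torus_topology n)"
    show "y \<in> torus_topology n closure_of (\<rho> ` carrier G)"
      unfolding in_closure_of
    proof (intro conjI y allI impI, elim conjE)
      fix T assume "y \<in> T" "openin (torus_topology n) T"
      then obtain U where U: "y \<in> (\<Pi>\<^sub>E i\<in>{..<n}. U i)" "(\<Pi>\<^sub>E i\<in>{..<n}. U i) \<subseteq> T"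
        "\<And>i. openin (top_of_set (sphere 0 1)) (U i)"
        unfolding torus_topology_def by (meson product_topology_open_contains_basis)
      have "\<exists>\<delta>>0. \<forall>w\<in>sphere 0 1. dist w (y i) < \<delta> \<longrightarrow> w \<in> U i" if "i < n" for i
      proof -
        have "y i \<in> U i"
          using PiE_mem[OF U(1)] that by simp
        then show ?thesis
          using U(3)[of i, unfolded openin_euclidean_subtopology_iff] by blast
      qed
      then obtain \<delta> where \<delta>: "\<And>i. i < n \<Longrightarrow> \<delta> i > 0"
        "\<And>i w. i < n \<Longrightarrow> w \<in> sphere 0 1 \<Longrightarrow> dist w (y i) < \<delta> i \<Longrightarrow> w \<in> U i"
        by metis
      \<comment> \<open>The inserted 1 keeps the set nonempty when \<open>n = 0\<close>.\<close>
      define \<delta>0 where "\<delta>0 = Min (insert 1 (\<delta> ` {..<n}))"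
      have \<delta>0: "\<delta>0 \<le> \<delta> i" if "i < n" for i
        using that by (auto simp: \<delta>0_def intro!: Min_le)
      have "\<delta>0 > 0"
        using \<delta>(1) by (auto simp: \<delta>0_def)
      then obtain x where x: "x \<in> carrier G" "\<And>i. i < n \<Longrightarrow> norm (\<rho> x i - y i) < \<delta>0"
        using torus_orbit_approximates[OF hom _ y[unfolded topspace_torus]] nontriv by blast
      have "\<rho> x \<in> carrier (torus_group n)"
        using img x(1) topspace_torus by blast
      moreover have "\<rho> x i \<in> U i" if "i < n" for i
        using \<delta>(2)[of i "\<rho> x i"] \<delta>0[OF that] x(2)[OF that] that norm_torus_component[OF calculation that]
        by (simp add: dist_norm)
      ultimately have "\<rho> x \<in> (\<Pi>\<^sub>E i\<in>{..<n}. U i)"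
        by (auto simp: carrier_torus_group PiE_iff)
      then show "\<exists>z. z \<in> \<rho> ` carrier G \<and> z \<in> T"
        using U(2) x(1) by blast
    qed
  qed
qed

subsection \<open>The row module\<close>

text \<open>A homogeneous system with more unknowns than equations, solved by fraction-free Gaussian
  elimination so that all numbers stay integral. It is the dimension count behind the rank
  bounds.\<close>

lemma exists_int_relation:
  fixes a :: "'i \<Rightarrow> 'j \<Rightarrow> int"
  assumes "finite J" "finite I" "card J < card I"
  shows "\<exists>x. (\<exists>i\<in>I. x i \<noteq> 0) \<and> (\<forall>j\<in>J. (\<Sum>i\<in>I. x i * a i j) = 0)"
  using assms
proof (induction J arbitrary: I a rule: finite_induct)
  case empty
  then have "I \<noteq> {}" by auto
  then show ?case by (auto intro!: exI[of _ "\<lambda>_. 1"])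
next
  case (insert l J)
  show ?case
  proof (cases "\<forall>i\<in>I. a i l = 0")
    case True
    have "card J < card I"
      using insert.hyps insert.prems by simp
    then obtain x where "\<exists>i\<in>I. x i \<noteq> 0" "\<forall>j\<in>J. (\<Sum>i\<in>I. x i * a i j) = 0"
      using insert.IH insert.prems by blast
    then show ?thesis
      using True by (intro exI[of _ x]) auto
  next
    case False
    then obtain k where k: "k \<in> I" "a k l \<noteq> 0" by blast
    \<comment> \<open>With pivot \<open>a k l\<close>, cross-multiplication by equation
      \<open>l\<close> eliminates unknown \<open>k\<close> from the other equations without
      division.\<close>
    have "card J < card (I - {k})"
      using insert.hyps insert.prems k by simp
    then obtain x where x: "\<exists>i\<in>I - {k}. x i \<noteq> 0"
      "\<forall>j\<in>J. (\<Sum>i\<in>I - {k}. x i * (a k l * a i j - a i l * a k j)) = 0"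
      using insert.IH[of "I - {k}" "\<lambda>i j. a k l * a i j - a i l * a k j"] insert.prems by blast
    \<comment> \<open>Back substitution: scaling the other unknowns by the pivot makes the value of
      unknown \<open>k\<close> integral. Equation \<open>l\<close> then holds because its reduced
      coefficients \<open>a k l * a i l - a i l * a k l\<close> vanish.\<close>
    define y where "y i = (if i = k then - (\<Sum>i\<in>I - {k}. x i * a i l) else a k l * x i)" for i
    have "(\<Sum>i\<in>I. y i * a i j) = (\<Sum>i\<in>I - {k}. x i * (a k l * a i j - a i l * a k j))" for j
    proof -
      have "(\<Sum>i\<in>I - {k}. y i * a i j) = (\<Sum>i\<in>I - {k}. a k l * x i * a i j)"
        by (intro sum.cong) (auto simp: y_def)
      then have "(\<Sum>i\<in>I. y i * a i j)
          = - (\<Sum>i\<in>I - {k}. x i * a i l) * a k j + (\<Sum>i\<in>I - {k}. a k l * x i * a i j)"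
        using k insert.prems by (simp add: sum.remove y_def)
      then show ?thesis
        by (simp add: sum_distrib_left sum_distrib_right sum_subtractf algebra_simps)
    qed
    then have "\<forall>j\<in>insert l J. (\<Sum>i\<in>I. y i * a i j) = 0"
      using x(2) by (simp add: mult.commute)
    moreover have "\<exists>i\<in>I. y i \<noteq> 0"
      using x(1) k by (auto simp: y_def)
    ultimately show ?thesis by blast
  qed
qed

section \<open>Integer combinations of the rows\<close>

definition row_comb :: "real mat \<Rightarrow> (nat \<Rightarrow> int) \<Rightarrow> real Matrix.vec" where
  "row_comb M m = Matrix.vec (dim_col M) (\<lambda>j. \<Sum>i<dim_row M. of_int (m i) * M $$ (i, j))"

lemma dim_row_comb [simp]: "dim_vec (row_comb M m) = dim_col M"
  by (simp add: row_comb_def)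

lemma index_row_comb:
  "j < dim_col M \<Longrightarrow> vec_index (row_comb M m) j = (\<Sum>i<dim_row M. of_int (m i) * M $$ (i, j))"
  by (simp add: row_comb_def)

lemma int_pow_monoid_vec:
  fixes v :: "real Matrix.vec" and k :: int
  assumes v: "v \<in> carrier_vec d"
  shows "v [^]\<^bsub>monoid_vec TYPE(real) d\<^esub> k = of_int k \<cdot>\<^sub>v v"
proof -
  let ?V = "monoid_vec TYPE(real) d"
  interpret comm_group ?V by (rule comm_group_vec)
  have nat: "v [^]\<^bsub>?V\<^esub> j = of_nat j \<cdot>\<^sub>v v" for j :: nat
  proof (induction j)
    case 0
    show ?case using v by (intro eq_vecI) (auto simp: monoid_vec_simps)
  next
    case (Suc j)
    then show ?case
      using v by (intro eq_vecI) (auto simp: monoid_vec_simps algebra_simps)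
  qed
  show ?thesis
  proof (cases "k < 0")
    case True
    have "inv\<^bsub>?V\<^esub> (of_nat (nat (- k)) \<cdot>\<^sub>v v) = of_int k \<cdot>\<^sub>v v"
      using v True by (intro inv_equality) (auto simp: monoid_vec_simps intro!: eq_vecI)
    then show ?thesis
      using True by (simp only: int_pow_def2 nat if_True)
  next
    case False
    then show ?thesis
      by (simp add: int_pow_def2 nat)
  qed
qed

lemma carrier_int_row_module: "carrier (int_row_module M) = range (row_comb M)"
proof -
  let ?V = "monoid_vec TYPE(real) (dim_col M)"
  interpret comm_group ?V by (rule comm_group_vec)
  have rows: "set (Matrix.rows M) = Matrix.row M ` {..<dim_row M}"
    by (auto simp: Matrix.rows_def)
  \<comment> \<open>\<open>subgroup_generated\<close> intersects its generators with the carrier;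
    the rows lie there already.\<close>
  have gen: "carrier (int_row_module M) = generate ?V (Matrix.row M ` {..<dim_row M})"
    unfolding int_row_module_def carrier_subgroup_generated rows
    by (intro arg_cong[of _ _ "generate ?V"]) (auto simp: monoid_vec_simps)
  show ?thesis
  proof (intro equalityI subsetI)
    fix v assume "v \<in> carrier (int_row_module M)"
    then have "v \<in> generate ?V (Matrix.row M ` {..<dim_row M})"
      by (simp only: gen)
    then show "v \<in> range (row_comb M)"
    proof induction
      case one
      have "0\<^sub>v (dim_col M) = row_comb M (\<lambda>_. 0)"
        by (auto simp: row_comb_def)
      then show ?case by (auto simp: monoid_vec_simps)
    next
      case (incl h)
      then obtain k where k: "k < dim_row M" "h = Matrix.row M k" by auto
      then have "h = row_comb M (\<lambda>i. if i = k then 1 else 0)"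
        by (intro eq_vecI) (auto simp: row_comb_def if_distrib if_distribR cong: if_cong)
      then show ?case by blast
    next
      case (inv h)
      then obtain k where k: "k < dim_row M" "h = Matrix.row M k" by auto
      have "inv\<^bsub>?V\<^esub> h = h [^]\<^bsub>?V\<^esub> (-1::int)"
        using k by (simp add: int_pow_def2 monoid_vec_simps)
      also have "\<dots> = - 1 \<cdot>\<^sub>v h"
        using k by (simp add: int_pow_monoid_vec)
      also have "\<dots> = row_comb M (\<lambda>i. if i = k then -1 else 0)"
        using k by (intro eq_vecI) (auto simp: row_comb_def if_distrib if_distribR cong: if_cong)
      finally show ?case by blast
    next
      case (eng h1 h2)
      then obtain m1 m2 where "h1 = row_comb M m1" "h2 = row_comb M m2" by auto
      then have "h1 \<otimes>\<^bsub>?V\<^esub> h2 = row_comb M (\<lambda>i. m1 i + m2 i)"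
        by (intro eq_vecI) (auto simp: monoid_vec_simps row_comb_def algebra_simps sum.distrib)
      then show ?case by blast
    qed
  next
    fix v assume "v \<in> range (row_comb M)"
    then obtain m where v: "v = row_comb M m" by blast
    interpret H: subgroup "carrier (int_row_module M)" ?V
      unfolding int_row_module_def by (rule subgroup_subgroup_generated)
    \<comment> \<open>The rows are added one at a time; \<open>k = dim_row M\<close> gives the whole
      combination.\<close>
    have "Matrix.vec (dim_col M) (\<lambda>j. \<Sum>i<k. of_int (m i) * M $$ (i, j)) \<in> carrier (int_row_module M)"
      if "k \<le> dim_row M" for k
      using that
    proof (induction k)
      case 0
      have "Matrix.vec (dim_col M) (\<lambda>j. \<Sum>i<0. of_int (m i) * M $$ (i, j)) = \<one>\<^bsub>?V\<^esub>"
        by (auto simp: monoid_vec_simps)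
      then show ?case by (simp only: H.one_closed)
    next
      case (Suc k)
      have row: "Matrix.row M k \<in> carrier (int_row_module M)"
        unfolding gen using Suc.prems by (intro generate.incl) auto
      have "Matrix.row M k [^]\<^bsub>?V\<^esub> m k \<in> carrier (int_row_module M)"
        using subgroup_int_pow_closed[OF H.subgroup_axioms row] .
      then have "of_int (m k) \<cdot>\<^sub>v Matrix.row M k \<in> carrier (int_row_module M)"
        by (simp add: int_pow_monoid_vec)
      with Suc have "Matrix.vec (dim_col M) (\<lambda>j. \<Sum>i<k. of_int (m i) * M $$ (i, j))
          \<otimes>\<^bsub>?V\<^esub> (of_int (m k) \<cdot>\<^sub>v Matrix.row M k) \<in> carrier (int_row_module M)"
        by (intro H.m_closed) auto
      also have "Matrix.vec (dim_col M) (\<lambda>j. \<Sum>i<k. of_int (m i) * M $$ (i, j))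
          \<otimes>\<^bsub>?V\<^esub> (of_int (m k) \<cdot>\<^sub>v Matrix.row M k)
          = Matrix.vec (dim_col M) (\<lambda>j. \<Sum>i<Suc k. of_int (m i) * M $$ (i, j))"
        using Suc.prems by (intro eq_vecI) (auto simp: monoid_vec_simps)
      finally show ?case .
    qed
    then show "v \<in> carrier (int_row_module M)"
      unfolding v row_comb_def by blast
  qed
qed

lemma one_int_row_module: "\<one>\<^bsub>int_row_module M\<^esub> = 0\<^sub>v (dim_col M)"
  by (simp add: int_row_module_def monoid_vec_simps)

lemma mult_int_row_module: "(\<otimes>\<^bsub>int_row_module M\<^esub>) = (+)"
  by (simp add: int_row_module_def monoid_vec_simps)

text \<open>Powers in the generated subgroup agree with those in the ambient vector group, where
  they are scalar multiples; so \<open>int_independent\<close> becomes ordinary linear independence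
  over the integers.\<close>

lemma finprod_int_row_module:
  assumes "finite B" "B \<subseteq> range (row_comb M)"
  shows "finprod (int_row_module M) (\<lambda>b. b [^]\<^bsub>int_row_module M\<^esub> c b) B
    = Matrix.vec (dim_col M) (\<lambda>j. \<Sum>b\<in>B. of_int (c b) * vec_index b j)"
proof -
  let ?V = "monoid_vec TYPE(real) (dim_col M)"
  interpret V: comm_group ?V by (rule comm_group_vec)
  interpret comm_group "int_row_module M"
    unfolding int_row_module_def by (rule V.abelian_subgroup_generated) (rule comm_group_vec)
  show ?thesis
    using assms
  proof (induction B rule: finite_induct)
    case empty
    then show ?case
      by (auto simp: one_int_row_module)
  next
    case (insert b B)
    have b: "b \<in> carrier (int_row_module M)"
      using insert.prems unfolding carrier_int_row_module by simp
    have b': "b \<in> carrier_vec (dim_col M)"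
      using b unfolding carrier_int_row_module by (elim rangeE) (simp add: carrier_vecI)
    have "(\<lambda>b. b [^]\<^bsub>int_row_module M\<^esub> c b) \<in> B \<rightarrow> carrier (int_row_module M)"
      using insert.prems unfolding carrier_int_row_module[symmetric]
      by (intro Pi_I int_pow_closed) blast
    then have "finprod (int_row_module M) (\<lambda>b. b [^]\<^bsub>int_row_module M\<^esub> c b) (insert b B)
        = b [^]\<^bsub>int_row_module M\<^esub> c b \<otimes>\<^bsub>int_row_module M\<^esub>
          Matrix.vec (dim_col M) (\<lambda>j. \<Sum>b\<in>B. of_int (c b) * vec_index b j)"
      using insert b by simp
    also have "b [^]\<^bsub>int_row_module M\<^esub> c b = of_int (c b) \<cdot>\<^sub>v b"
      using b b' unfolding int_row_module_def
      by (simp add: V.int_pow_subgroup_generated int_pow_monoid_vec)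
    finally show ?case
      using insert.hyps b'
      by (auto simp: mult_int_row_module intro!: eq_vecI)
  qed
qed

section \<open>Independence and rank in the row module\<close>

lemma int_independent_row_module_iff:
  "int_independent (int_row_module M) B \<longleftrightarrow> finite B \<and> B \<subseteq> range (row_comb M) \<and>
    (\<forall>c :: _ \<Rightarrow> int. (\<forall>j<dim_col M. (\<Sum>b\<in>B. of_int (c b) * vec_index b j) = 0) \<longrightarrow> (\<forall>b\<in>B. c b = 0))"
proof -
  have "Matrix.vec d f = 0\<^sub>v d \<longleftrightarrow> (\<forall>j<d. f j = 0)" for d and f :: "nat \<Rightarrow> real"
    by (auto simp: vec_eq_iff)
  then show ?thesis
    unfolding int_independent_def carrier_int_row_module one_int_row_module
    by (auto simp: finprod_int_row_module)
qed

text \<open>A Steinitz bound up to a multiple: if \<open>B\<close> had more elements than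
  \<open>R\<close>, the coefficient vectors of the multiples by \<open>N\<close> would satisfy an
  integer relation. The factor \<open>N\<close> stands in for division by an integer.\<close>

lemma card_int_independent_le:
  assumes indep: "int_independent (int_row_module M) B" and "finite R" and "N \<noteq> 0"
    and comb: "\<And>b. b \<in> B \<Longrightarrow> \<exists>a :: nat \<Rightarrow> int. \<forall>j<dim_col M.
      of_int N * vec_index b j = (\<Sum>i\<in>R. of_int (a i) * M $$ (i, j))"
  shows "card B \<le> card R"
proof (rule ccontr)
  assume "\<not> card B \<le> card R"
  moreover have "finite B"
    using indep by (simp add: int_independent_def)
  moreover obtain a :: "_ \<Rightarrow> nat \<Rightarrow> int" where a: "\<And>b j. b \<in> B \<Longrightarrow> j < dim_col M \<Longrightarrow>
      of_int N * vec_index b j = (\<Sum>i\<in>R. of_int (a b i) * M $$ (i, j))"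
    using comb by metis
  ultimately obtain x where x: "\<exists>b\<in>B. x b \<noteq> 0" "\<forall>i\<in>R. (\<Sum>b\<in>B. x b * a b i) = 0"
    using exists_int_relation[of R B a] assms(2) by auto
  \<comment> \<open>The relation \<open>x\<close> holds for the multiples by \<open>N\<close>, so on
    \<open>B\<close> itself its coefficients are \<open>x b * N\<close>, not all zero.\<close>
  have "(\<Sum>b\<in>B. of_int (x b * N) * vec_index b j) = 0" if j: "j < dim_col M" for j
  proof -
    have "(\<Sum>b\<in>B. of_int (x b * N) * vec_index b j)
        = (\<Sum>b\<in>B. \<Sum>i\<in>R. of_int (x b * a b i) * M $$ (i, j))"
      by (intro sum.cong refl) (simp add: a[OF _ j] mult.assoc sum_distrib_left)
    also have "\<dots> = (\<Sum>i\<in>R. of_int (\<Sum>b\<in>B. x b * a b i) * M $$ (i, j))"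
      by (subst sum.swap) (simp add: sum_distrib_right)
    finally show ?thesis
      using x(2) by simp
  qed
  moreover have "(\<forall>j<dim_col M. (\<Sum>b\<in>B. of_int (x b * N) * vec_index b j) = 0) \<longrightarrow> (\<forall>b\<in>B. x b * N = 0)"
    using indep unfolding int_independent_row_module_iff by (elim conjE) (erule spec)
  ultimately have "\<forall>b\<in>B. x b * N = 0"
    by blast
  then show False
    using x(1) \<open>N \<noteq> 0\<close> by simp
qed

text \<open>Translates the rank, a maximum over independent sets in the module, into independence of
  the rows as an indexed family.\<close>

lemma int_row_rank_eq_dim_row_iff:
  "int_row_rank M = dim_row M
    \<longleftrightarrow> (\<forall>m. row_comb M m = 0\<^sub>v (dim_col M) \<longrightarrow> (\<forall>i<dim_row M. m i = 0))"
    (is "_ \<longleftrightarrow> ?free")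
proof -
  let ?n = "dim_row M"
  let ?K = "{card B | B. int_independent (int_row_module M) B}"
  \<comment> \<open>Besides bounding the rank, this makes \<open>?K\<close> finite, so that
    \<open>Max\<close> is attained.\<close>
  have le: "card B \<le> ?n" if "int_independent (int_row_module M) B" for B
  proof -
    have "\<exists>a :: nat \<Rightarrow> int. \<forall>j<dim_col M. of_int 1 * vec_index b j = (\<Sum>i<?n. of_int (a i) * M $$ (i, j))"
      if "b \<in> B" for b
    proof -
      have "b \<in> range (row_comb M)"
        using \<open>int_independent _ B\<close> that unfolding int_independent_row_module_iff by blast
      then obtain a where "b = row_comb M a" by blast
      then show ?thesis by (auto simp: index_row_comb)
    qed
    then have "card B \<le> card {..<?n}"
      by (intro card_int_independent_le[OF that, of _ 1]) simp_all
    then show ?thesis by simp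
  qed
  have "int_independent (int_row_module M) {}"
    by (simp add: int_independent_row_module_iff)
  then have K: "finite ?K" "?K \<noteq> {}"
    using le by (auto intro!: finite_subset[of ?K "{..?n}"])
  have rank: "int_row_rank M = Max ?K"
    by (simp add: int_row_rank_def int_rank_def)
  show ?thesis
  proof
    \<comment> \<open>A relation with \<open>m k \<noteq> 0\<close> puts \<open>m k\<close> times the row module into the span of the other rows.\<close>
    assume "int_row_rank M = ?n"
    then have "?n \<in> ?K"
      using Max_in[OF K] rank by simp
    then obtain B where B: "int_independent (int_row_module M) B" "card B = ?n"
      by force
    show ?free
    proof (rule ccontr)
      assume "\<not> ?free"
      then obtain m k where m: "row_comb M m = 0\<^sub>v (dim_col M)" and k: "k < ?n" "m k \<noteq> 0"
        by blast
      have rel: "of_int (m k) * M $$ (k, j) = - (\<Sum>i\<in>{..<?n} - {k}. of_int (m i) * M $$ (i, j))"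
        if "j < dim_col M" for j
      proof -
        have "(\<Sum>i<?n. of_int (m i) * M $$ (i, j)) = 0"
          using index_row_comb[OF that, of m] m that by simp
        then show ?thesis
          using k by (simp add: sum.remove[of "{..<?n}" k])
      qed
      have comb: "\<exists>a :: nat \<Rightarrow> int. \<forall>j<dim_col M. of_int (m k) * vec_index b j
          = (\<Sum>i\<in>{..<?n} - {k}. of_int (a i) * M $$ (i, j))" if "b \<in> B" for b
      proof -
        have "b \<in> range (row_comb M)"
          using B(1) that unfolding int_independent_row_module_iff by blast
        then obtain a where a: "b = row_comb M a" by blast
        \<comment> \<open>After multiplication by \<open>m k\<close>, the contribution
          \<open>a k\<close> of row \<open>k\<close> is replaced through \<open>rel\<close>, which
          subtracts \<open>a k * m i\<close> from the coefficient of row \<open>i\<close>.\<close>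
        show ?thesis
        proof (intro exI[of _ "\<lambda>i. m k * a i - a k * m i"] allI impI)
          fix j assume j: "j < dim_col M"
          have "of_int (m k) * vec_index b j = of_int (a k) * (of_int (m k) * M $$ (k, j))
              + (\<Sum>i\<in>{..<?n} - {k}. of_int (m k) * (of_int (a i) * M $$ (i, j)))"
            using k j by (simp add: a index_row_comb sum.remove[of "{..<?n}" k] sum_distrib_left algebra_simps)
          then show "of_int (m k) * vec_index b j
              = (\<Sum>i\<in>{..<?n} - {k}. of_int (m k * a i - a k * m i) * M $$ (i, j))"
            unfolding rel[OF j] by (simp add: sum_distrib_left sum_subtractf algebra_simps)
        qed
      qed
      have "card B \<le> card ({..<?n} - {k})"
        by (rule card_int_independent_le[OF B(1) _ k(2) comb]) simp
      also have "\<dots> < card {..<?n}"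
        using k(1) by (intro card_Diff1_less) auto
      finally show False
        unfolding B(2) card_lessThan by blast
    qed
  next
    assume free: ?free
    have comb_eq: "row_comb M (\<lambda>i. if i = k then 1 else 0) = Matrix.row M k" if "k < ?n" for k
      using that by (intro eq_vecI) (auto simp: row_comb_def if_distrib if_distribR cong: if_cong)
    \<comment> \<open>Independence concerns sets, so repeated rows would lower the cardinality. A
      repetition is excluded as the relation with coefficients 1 and -1.\<close>
    have inj: "inj_on (Matrix.row M) {..<?n}"
    proof (rule inj_onI)
      fix k l assume kl: "k \<in> {..<?n}" "l \<in> {..<?n}" "Matrix.row M k = Matrix.row M l"
      define m :: "nat \<Rightarrow> int" where "m i = (if i = k then 1 else 0) - (if i = l then 1 else 0)" for i
      have "row_comb M m = row_comb M (\<lambda>i. if i = k then 1 else 0) - row_comb M (\<lambda>i. if i = l then 1 else 0)"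
        by (intro eq_vecI) (auto simp: row_comb_def m_def left_diff_distrib sum_subtractf)
      then have "row_comb M m = 0\<^sub>v (dim_col M)"
        using kl by (auto simp: comb_eq)
      then have "m k = 0"
        using free kl by blast
      then show "k = l"
        by (auto simp: m_def split: if_splits)
    qed
    have "int_independent (int_row_module M) (Matrix.row M ` {..<?n})"
      unfolding int_independent_row_module_iff
    proof (intro conjI allI impI)
      show "Matrix.row M ` {..<?n} \<subseteq> range (row_comb M)"
        using comb_eq by (metis (no_types, lifting) image_subsetI lessThan_iff rangeI)
      fix c :: "real Matrix.vec \<Rightarrow> int"
      assume c: "\<forall>j<dim_col M. (\<Sum>b\<in>Matrix.row M ` {..<?n}. of_int (c b) * vec_index b j) = 0"
      have "row_comb M (\<lambda>i. c (Matrix.row M i)) = 0\<^sub>v (dim_col M)"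
        using c by (intro eq_vecI) (auto simp: index_row_comb sum.reindex[OF inj])
      then show "\<forall>b\<in>Matrix.row M ` {..<?n}. c b = 0"
        using free by blast
    qed simp
    moreover have "card (Matrix.row M ` {..<?n}) = ?n"
      using inj by (simp add: card_image)
    ultimately have "?n \<in> ?K"
      by (metis (mono_tags, lifting) mem_Collect_eq)
    then show "int_row_rank M = ?n"
      unfolding rank using K le by (intro Max_eqI) auto
  qed
qed

text \<open>Full rank forbids a nonzero \<open>m\<close> with zero combination, freeness forbids
  nonzero combinations in \<open>pi_rat_vecs\<close>. As zero lies in \<open>pi_rat_vecs\<close>,
  the two merge into one condition on \<open>m\<close>.\<close>

lemma int_row_rank_and_pi_rat_free_iff:
  "int_row_rank M = dim_row M \<and> pi_rat_free_rows M
    \<longleftrightarrow> (\<forall>m. (\<exists>i<dim_row M. m i \<noteq> 0) \<longrightarrow> row_comb M m \<notin> pi_rat_vecs (dim_col M))"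
proof -
  have zero: "0\<^sub>v (dim_col M) \<in> pi_rat_vecs (dim_col M)"
    by (auto simp: pi_rat_vecs_def intro!: bexI[of _ 0])
  have comb0: "row_comb M m = 0\<^sub>v (dim_col M)" if "\<forall>i<dim_row M. m i = 0" for m
    using that by (auto simp: row_comb_def)
  have "pi_rat_free_rows M
    \<longleftrightarrow> (\<forall>m. row_comb M m \<in> pi_rat_vecs (dim_col M) \<longrightarrow> row_comb M m = 0\<^sub>v (dim_col M))"
    unfolding pi_rat_free_rows_def carrier_int_row_module
    using zero comb0[of "\<lambda>_. 0"] rangeI[of "row_comb M" "\<lambda>_. 0"] by (auto simp: set_eq_iff)
  then show ?thesis
    unfolding int_row_rank_eq_dim_row_iff using zero comb0 by metis
qed

lemma common_denominator:
  fixes f :: "nat \<Rightarrow> real"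
  assumes "\<And>j. j < d \<Longrightarrow> f j \<in> \<rat>"
  shows "\<exists>N::int. N \<noteq> 0 \<and> (\<forall>j<d. of_int N * f j \<in> \<int>)"
  using assms
proof (induction d)
  case 0
  show ?case by (auto intro: exI[of _ 1])
next
  case (Suc d)
  then obtain N :: int where N: "N \<noteq> 0" "\<forall>j<d. of_int N * f j \<in> \<int>"
    by (meson less_SucI)
  obtain a b :: int where ab: "b > 0" "f d = of_int a / of_int b"
    using Suc.prems[of d] by (metis Rats_cases' lessI)
  have "of_int (b * N) * f j \<in> \<int>" if "j < Suc d" for j
  proof (cases "j = d")
    case True
    then show ?thesis using ab by simp
  next
    case False
    then have "of_int N * f j \<in> \<int>"
      using N(2) that by auto
    then have "of_int b * (of_int N * f j) \<in> \<int>"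
      by (rule Ints_mult[OF Ints_of_int])
    then show ?thesis by (simp only: of_int_mult mult.assoc)
  qed
  then show ?case
    using N ab by (intro exI[of _ "b * N"]) auto
qed

subsection \<open>The density criterion\<close>

theorem theorem3p1:
  fixes S :: "'a::topological_space set" and x :: 'a and \<mu> :: "'a chain set"
    and g n :: nat and \<alpha> \<beta> :: "nat \<Rightarrow> (real \<Rightarrow> 'a) set"
    and \<rho> :: "(real \<Rightarrow> 'a) set \<Rightarrow> nat \<Rightarrow> complex"
  assumes "closed_surface (top_of_set S)" and "connected S"
    and "surface_orientation (top_of_set S) \<mu>"
    and "has_genus (top_of_set S) g" and "g \<ge> 1" and "n \<ge> 1"
    and "x \<in> S"
    and "standard_generators (fundamental_group S x) g \<alpha> \<beta>"
    and "\<rho> \<in> hom (fundamental_group S x) (torus_group n)"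
  shows "torus_topology n closure_of (\<rho> ` carrier (fundamental_group S x)) = topspace (torus_topology n)
    \<longleftrightarrow> int_row_rank (angle_matrix n g \<alpha> \<beta> \<rho>) = n \<and> pi_rat_free_rows (angle_matrix n g \<alpha> \<beta> \<rho>)"
proof -
  let ?G = "fundamental_group S x"
  interpret group ?G
    using assms(7) by (rule group_fundamental_group)
  define M where "M = angle_matrix n g \<alpha> \<beta> \<rho>"
  \<comment> \<open>The generators interleaved in the order of the columns.\<close>
  define a where "a j = (if even j then \<alpha> (j div 2) else \<beta> (j div 2))" for j
  have dims [simp]: "dim_row M = n" "dim_col M = 2 * g"
    by (simp_all add: M_def angle_matrix_def)
  have entry: "M $$ (i, j) = Arg2pi (\<rho> (a j) i)" if "i < n" "j < 2 * g" for i j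
    using that by (simp add: M_def angle_matrix_def a_def)
  have a_even: "a (2 * l) = \<alpha> l" and a_odd: "a (2 * l + 1) = \<beta> l" for l
    by (simp_all add: a_def)
  have gens: "a ` {..<2 * g} = \<alpha> ` {..<g} \<union> \<beta> ` {..<g}"
  proof (intro equalityI subsetI)
    fix y assume "y \<in> \<alpha> ` {..<g} \<union> \<beta> ` {..<g}"
    then obtain l where "l < g" "y = a (2 * l) \<or> y = a (2 * l + 1)"
      using a_even a_odd by auto
    then show "y \<in> a ` {..<2 * g}"
      by (elim disjE) auto
  qed (auto simp: a_def)
  have a_in: "a ` {..<2 * g} \<subseteq> carrier ?G" and a_gen: "generate ?G (a ` {..<2 * g}) = carrier ?G"
    using assms(8) unfolding standard_generators_def gens by auto
  have \<rho>_in: "\<rho> y \<in> carrier (torus_group n)" if "y \<in> carrier ?G" for y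
    using assms(9) that by (auto simp: hom_def)
  \<comment> \<open>On the generator \<open>a j\<close> the character is exp(i t), with t the
    \<open>j\<close>-th entry of \<open>row_comb M m\<close>.\<close>
  have char_gen: "torus_char n m (\<rho> (a j)) = 1 \<longleftrightarrow> (\<exists>k::int. vec_index (row_comb M m) j = of_int (2 * k) * pi)"
    if j: "j < 2 * g" for m j
  proof -
    have "\<rho> (a j) i powi m i = exp (of_int (m i) * (\<i> * of_real (M $$ (i, j))))" if i: "i < n" for i
    proof -
      have "norm (\<rho> (a j) i) = 1"
        using a_in j i by (intro norm_torus_component[OF \<rho>_in]) auto
      then have "\<rho> (a j) i = exp (\<i> * of_real (M $$ (i, j)))"
        unfolding entry[OF i j] complex_norm_eq_1_exp by (rule sym)
      then show ?thesis
        by (simp only: exp_power_int)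
    qed
    then have "torus_char n m (\<rho> (a j)) = exp (\<Sum>i<n. of_int (m i) * (\<i> * of_real (M $$ (i, j))))"
      by (simp add: torus_char_def exp_sum)
    also have "(\<Sum>i<n. of_int (m i) * (\<i> * of_real (M $$ (i, j)))) = \<i> * of_real (vec_index (row_comb M m) j)"
      using j by (simp add: index_row_comb sum_distrib_left mult_ac)
    finally show ?thesis
      by (simp add: exp_eq_1)
  qed
  \<comment> \<open>Composed with \<open>\<rho>\<close>, the character is multiplicative and
    nonvanishing, so the generators decide.\<close>
  have char_triv: "(\<forall>y\<in>carrier ?G. torus_char n m (\<rho> y) = 1)
      \<longleftrightarrow> (\<forall>j<2 * g. \<exists>k::int. vec_index (row_comb M m) j = of_int (2 * k) * pi)" for m
  proof
    assume "\<forall>y\<in>carrier ?G. torus_char n m (\<rho> y) = 1"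
    then show "\<forall>j<2 * g. \<exists>k::int. vec_index (row_comb M m) j = of_int (2 * k) * pi"
      using char_gen a_in by (metis image_subset_iff lessThan_iff)
  next
    assume per: "\<forall>j<2 * g. \<exists>k::int. vec_index (row_comb M m) j = of_int (2 * k) * pi"
    show "\<forall>y\<in>carrier ?G. torus_char n m (\<rho> y) = 1"
    proof
      fix y assume "y \<in> carrier ?G"
      then show "torus_char n m (\<rho> y) = 1"
      proof (rule multiplicative_eq_1_on_generators[OF _ _ a_in a_gen, rotated 3])
        show "torus_char n m (\<rho> (y \<otimes>\<^bsub>?G\<^esub> z)) = torus_char n m (\<rho> y) * torus_char n m (\<rho> z)"
          if "y \<in> carrier ?G" "z \<in> carrier ?G" for y z
          using hom_mult[OF assms(9) that] by (simp add: torus_char_mult)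
        show "torus_char n m (\<rho> y) \<noteq> 0" if "y \<in> carrier ?G" for y
          using norm_torus_char[OF \<rho>_in[OF that], of m] by auto
        show "torus_char n m (\<rho> s) = 1" if "s \<in> a ` {..<2 * g}" for s
          using that per char_gen by auto
      qed
    qed
  qed
  have "(\<forall>m. (\<exists>i<n. m i \<noteq> 0) \<longrightarrow> \<not> (\<forall>j<2 * g. \<exists>k::int. vec_index (row_comb M m) j = of_int (2 * k) * pi))
      \<longleftrightarrow> (\<forall>m. (\<exists>i<n. m i \<noteq> 0) \<longrightarrow> row_comb M m \<notin> pi_rat_vecs (2 * g))" (is "?aper \<longleftrightarrow> ?irrat")
  proof
    assume aper: ?aper
    show ?irrat
    proof (intro allI impI notI)
      fix m assume m: "\<exists>i<n. m i \<noteq> 0" and rat: "row_comb M m \<in> pi_rat_vecs (2 * g)"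
      \<comment> \<open>Dividing by \<open>2 * pi\<close> instead of \<open>pi\<close> makes the
        cleared denominators yield even multiples of \<open>pi\<close>.\<close>
      have "vec_index (row_comb M m) j / (2 * pi) \<in> \<rat>" if "j < 2 * g" for j
      proof -
        have "\<exists>q\<in>\<rat>. vec_index (row_comb M m) j = pi * q"
          using rat that by (simp add: pi_rat_vecs_def)
        then obtain q where "q \<in> \<rat>" "vec_index (row_comb M m) j = pi * q"
          by (rule bexE)
        then show ?thesis by simp
      qed
      then obtain N :: int where N: "N \<noteq> 0"
        "\<forall>j<2 * g. of_int N * (vec_index (row_comb M m) j / (2 * pi)) \<in> \<int>"
        using common_denominator[of "2 * g" "\<lambda>j. vec_index (row_comb M m) j / (2 * pi)"] by blast
      \<comment> \<open>The common denominator is absorbed into the exponents: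
        \<open>N * m i\<close> is again a nonzero exponent vector, now with entries in the periods
        of exp(i t).\<close>
      have "\<exists>k::int. vec_index (row_comb M (\<lambda>i. N * m i)) j = of_int (2 * k) * pi" if j: "j < 2 * g" for j
      proof -
        obtain k :: int where "of_int N * (vec_index (row_comb M m) j / (2 * pi)) = of_int k"
          using N(2) j by (auto elim: Ints_cases)
        then have "of_int N * vec_index (row_comb M m) j = of_int (2 * k) * pi"
          by (simp add: field_simps)
        moreover have "vec_index (row_comb M (\<lambda>i. N * m i)) j = of_int N * vec_index (row_comb M m) j"
          using j by (simp add: index_row_comb sum_distrib_left mult.assoc)
        ultimately show ?thesis by metis
      qed
      then have "\<forall>j<2 * g. \<exists>k::int. vec_index (row_comb M (\<lambda>i. N * m i)) j = of_int (2 * k) * pi"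
        by (intro allI impI)
      moreover have "\<exists>i<n. N * m i \<noteq> 0"
        using m N(1) by simp
      ultimately show False
        using aper[THEN spec, of "\<lambda>i. N * m i"] by (elim impE notE)
    qed
  next
    assume irrat: ?irrat
    show ?aper
    proof (intro allI impI notI)
      fix m assume m: "\<exists>i<n. m i \<noteq> 0"
        and per: "\<forall>j<2 * g. \<exists>k::int. vec_index (row_comb M m) j = of_int (2 * k) * pi"
      have "row_comb M m \<in> pi_rat_vecs (2 * g)"
        unfolding pi_rat_vecs_def
      proof (intro CollectI conjI allI impI)
        show "row_comb M m \<in> carrier_vec (2 * g)"
          by (simp add: carrier_vecI)
        show "\<exists>q\<in>\<rat>. vec_index (row_comb M m) j = pi * q" if j: "j < 2 * g" for j
        proof -
          obtain k :: int where "vec_index (row_comb M m) j = of_int (2 * k) * pi"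
            using per j by blast
          then show ?thesis
            by (intro bexI[of _ "of_int (2 * k)"]) (auto simp: mult.commute)
        qed
      qed
      then show False
        using irrat[THEN spec, of m] m by (elim impE notE)
    qed
  qed
  moreover have "(\<exists>y\<in>carrier ?G. torus_char n m (\<rho> y) \<noteq> 1)
      \<longleftrightarrow> \<not> (\<forall>j<2 * g. \<exists>k::int. vec_index (row_comb M m) j = of_int (2 * k) * pi)" for m
    unfolding char_triv[symmetric] by blast
  ultimately show ?thesis
    using int_row_rank_and_pi_rat_free_iff[of M]
    unfolding hom_torus_dense_iff[OF assms(9)] dims M_def[symmetric] by (simp only:)
qed

end
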